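(* Let $d\ge 3$ be an integer with $d\ne 4$ and let $F^2_d=(X_0^d+X_1^d+X_2^d+X_3^d=0)\subset\mathbb{P}^3_{\mathbb{C}}$. (a) If $d$ is odd, the correspondence between cocycles and real forms of $F^2_d$ is: - $H^4_2$: $(Y_0^d+Y_1^d+Y_2^d+Y_3^d=0)\subset\mathbb{P}^3_{\mathbb{R}}$; - $H^2_2$: $(Y_0^d+Y_1^d+(Y_2+\sqrt{-1}\,Y_3)^d+(Y_2-\sqrt{-1}\,Y_3)^d=0)\subset\mathbb{P}^3_{\mathbb{R}}$; - $H^0_2$: $((Y_0+\sqrt{-1}\,Y_1)^d+(Y_0-\sqrt{-1}\,Y_1)^d+(Y_2+\sqrt{-1}\,Y_3)^d+(Y_2-\sqrt{-1}\,Y_3)^d=0)\subset\mathbb{P}^3_{\mathbb{R}}$. (b) If $d$ is even, the correspondence between cocycles and real forms of $F^2_d$ is: - $K^{0,4}_2$: $(Y_0^d+Y_1^d+Y_2^d+Y_3^d=0)\subset\mathbb{P}^3_{\mathbb{R}}$; - $K^{1,3}_2$: $(-Y_0^d+Y_1^d+Y_2^d+Y_3^d=0)\subset\mathbb{P}^3_{\mathbb{R}}$; - $K^{2,2}_2$: $(-Y_0^d-Y_1^d+Y_2^d+Y_3^d=0)\subset\mathbb{P}^3_{\mathbb{R}}$; - $K^{0,2}_2$: $(Y_0^d+Y_1^d+(Y_2+\sqrt{-1}\,Y_3)^d+(Y_2-\sqrt{-1}\,Y_3)^d=0)\subset\mathbb{P}^3_{\mathbb{R}}$; - $K^{1,1}_2$: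 $(-Y_0^d+Y_1^d+(Y_2+\sqrt{-1}\,Y_3)^d+(Y_2-\sqrt{-1}\,Y_3)^d=0)\subset\mathbb{P}^3_{\mathbb{R}}$; - $K^{0,0}_2$: $((Y_0+\sqrt{-1}\,Y_1)^d+(Y_0-\sqrt{-1}\,Y_1)^d+(Y_2+\sqrt{-1}\,Y_3)^d+(Y_2-\sqrt{-1}\,Y_3)^d=0)\subset\mathbb{P}^3_{\mathbb{R}}$; - $L_2$: $Z^2_d$.
   Context: Let $\xi$ be a primitive $d$-th root of unity in $\mathbb{C}$. Let $\rho$ be the real structure on $F^2_d$ given by complex conjugation of the homogeneous coordinates. A cocycle is an automorphism $\alpha\in\operatorname{Aut}_{\mathbb{C}}F^2_d$ with $(\alpha\circ\rho)^2=\mathrm{id}$; the real form corresponding to $\alpha$ is the quotient of $F^2_d$ by the real structure $\alpha\circ\rho$, i.e. the real variety (unique up to $\mathbb{R}$-isomorphism) whose complexification is isomorphic to $F^2_d$ with complex conjugation corresponding to $\alpha\circ\rho$. Matrices denote the linear automorphisms they induce on homogeneous coordinates. Put $J=\begin{pmatrix}0&1\\1&0\end{pmatrix}$. For integers $r\in\{0,2,4\}$, $H^r_2$ is the $4\times4$ block diagonal matrix with blocks $I_r$ followed by $(4-r)/2$ copies of $J$. For integers $s,t\ge0$ with $s+t\le4$ and $s+t$ even, $K^{s,t}_2$ is the $4\times4$ block diagonal matrix with blocks $\xi I_s$, $I_t$, followed by $(4-s-t)/2$ copies of $J$. $L_2$ is the block diagonal matrix with two blocks $\begin{pmatrix}0&1\\-1&0\end{pmatrix}$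 (it preserves $F^2_d$ for $d$ even). For $d$ even, $Z^2_d$ is the quotient of $F^2_d$ by the restriction to $F^2_d$ of the real structure $[z_0:z_1:z_2:z_3]\mapsto[-\overline{z_1}:\overline{z_0}:-\overline{z_3}:\overline{z_2}]$ of $\mathbb{P}^3_{\mathbb{C}}$. *)

theory Defs
  imports Complex_Main "HOL-Library.FuncSet" "Jordan_Normal_Form.Matrix"
begin

section \<open>Complex projective space and regular maps\<close>

text \<open>A point of the complex projective \<open>n\<close>-space is represented by the set of all its vectors of
  homogeneous coordinates; coordinates are indexed by \<open>0, \<dots>, n\<close>.\<close>

type_synonym ppoint = "complex vec set"

definition ppoint :: "complex vec \<Rightarrow> ppoint" where
  "ppoint v = {c \<cdot>\<^sub>v v | c. c \<noteq> 0}"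

definition proj_space :: "nat \<Rightarrow> ppoint set" where
  "proj_space n = ppoint ` (carrier_vec (n + 1) - {0\<^sub>v (n + 1)})"

text \<open>\<open>hom_form K n k G\<close>: on vectors of homogeneous coordinates, \<open>G\<close> is a homogeneous polynomial of
  degree \<open>k\<close> (possibly zero) in \<open>n + 1\<close> variables with coefficients in \<open>K\<close>. The sum runs over the
  exponent vectors of total degree \<open>k\<close>.\<close>

definition hom_form :: "complex set \<Rightarrow> nat \<Rightarrow> nat \<Rightarrow> (complex vec \<Rightarrow> complex) \<Rightarrow> bool" where
  "hom_form K n k G \<longleftrightarrow> (\<exists>c :: (nat \<Rightarrow> nat) \<Rightarrow> complex. range c \<subseteq> K \<and>
     (\<forall>v \<in> carrier_vec (n + 1).
        G v = (\<Sum>a \<in> {a \<in> {..n} \<rightarrow>\<^sub>E {..k}. (\<Sum>i\<le>n. a i) = k}. c a * (\<Prod>i\<le>n. (v $ i) ^ a i))))"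

definition proj_zeros :: "nat \<Rightarrow> (complex vec \<Rightarrow> complex) \<Rightarrow> ppoint set" where
  "proj_zeros n G = {p \<in> proj_space n. \<forall>v \<in> p. G v = 0}"

definition zariski_closed :: "nat \<Rightarrow> ppoint set \<Rightarrow> bool" where
  "zariski_closed n X \<longleftrightarrow> (\<exists>S. (\<forall>G \<in> S. \<exists>k. hom_form UNIV n k G) \<and>
     X = {p \<in> proj_space n. \<forall>G \<in> S. p \<in> proj_zeros n G})"

text \<open>Near every point, a regular map is given by forms of equal degree without common zero. The
  Zariski neighbourhood of \<open>p\<close> is taken to be the whole locus in \<open>X\<close> where the forms do not vanish
  simultaneously; a smaller neighbourhood can always be brought to this shape by multiplying all
  the forms by one that vanishes outside it but not at \<open>p\<close>.\<close>

definition regular_map :: "nat \<Rightarrow> ppoint set \<Rightarrow> nat \<Rightarrow> ppoint set \<Rightarrow> (ppoint \<Rightarrow> ppoint) \<Rightarrow> bool" where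
  "regular_map m X n Y f \<longleftrightarrow> f ` X \<subseteq> Y \<and>
     (\<forall>p \<in> X. \<exists>k (P :: nat \<Rightarrow> complex vec \<Rightarrow> complex).
        (\<forall>j\<le>n. hom_form UNIV m k (P j)) \<and>
        (\<exists>v \<in> p. \<exists>j\<le>n. P j v \<noteq> 0) \<and>
        (\<forall>q \<in> X. \<forall>v \<in> q. (\<exists>j\<le>n. P j v \<noteq> 0) \<longrightarrow> f q = ppoint (vec (n + 1) (\<lambda>j. P j v))))"

definition biregular :: "nat \<Rightarrow> ppoint set \<Rightarrow> nat \<Rightarrow> ppoint set \<Rightarrow> (ppoint \<Rightarrow> ppoint) \<Rightarrow> bool" where
  "biregular m X n Y f \<longleftrightarrow> regular_map m X n Y f \<and>
     (\<exists>g. regular_map n Y m X g \<and> (\<forall>p \<in> X. g (f p) = p) \<and> (\<forall>q \<in> Y. f (g q) = q))"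

text \<open>Linear and conjugate-linear bijections of coordinate vectors act on points by taking images.\<close>

definition lin_map :: "complex mat \<Rightarrow> ppoint \<Rightarrow> ppoint" where
  "lin_map A p = (\<lambda>v. A *\<^sub>v v) ` p"

definition pconj :: "ppoint \<Rightarrow> ppoint" where
  "pconj p = conjugate ` p"


section \<open>Real varieties\<close>

text \<open>A real projective variety is given by its complexification together with the real structure
  (an antiregular involution) of which it is the quotient. A map \<open>\<sigma>\<close> is antiregular on \<open>X\<close> iff
  \<open>pconj \<circ> \<sigma>\<close> is a regular map from \<open>X\<close> to the conjugate variety of \<open>X\<close>.\<close>

type_synonym real_var = "ppoint set \<times> (ppoint \<Rightarrow> ppoint)"

definition real_structure :: "nat \<Rightarrow> ppoint set \<Rightarrow> (ppoint \<Rightarrow> ppoint) \<Rightarrow> bool" where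
  "real_structure n X \<sigma> \<longleftrightarrow> \<sigma> ` X \<subseteq> X \<and> (\<forall>p \<in> X. \<sigma> (\<sigma> p) = p) \<and>
     regular_map n X n (pconj ` X) (pconj \<circ> \<sigma>)"

definition real_variety :: "nat \<Rightarrow> real_var \<Rightarrow> bool" where
  "real_variety n R \<longleftrightarrow> zariski_closed n (fst R) \<and> real_structure n (fst R) (snd R)"

definition real_isomorphic :: "nat \<Rightarrow> real_var \<Rightarrow> nat \<Rightarrow> real_var \<Rightarrow> bool" where
  "real_isomorphic m R n S \<longleftrightarrow> (\<exists>\<Phi>. biregular m (fst R) n (fst S) \<Phi> \<and>
     (\<forall>p \<in> fst R. \<Phi> (snd R p) = snd S (\<Phi> p)))"

text \<open>The closed subvariety \<open>(G = 0)\<close> of real projective \<open>n\<close>-space; meaningful for forms \<open>G\<close> with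
  real coefficients.\<close>

definition real_hypersurface :: "nat \<Rightarrow> (complex vec \<Rightarrow> complex) \<Rightarrow> real_var" where
  "real_hypersurface n G = (proj_zeros n G, pconj)"


section \<open>Fermat surfaces, cocycles and their real forms\<close>

definition fermat :: "nat \<Rightarrow> ppoint set" where
  "fermat d = proj_zeros 3 (\<lambda>x. (x $ 0) ^ d + (x $ 1) ^ d + (x $ 2) ^ d + (x $ 3) ^ d)"

definition cocycle :: "nat \<Rightarrow> (ppoint \<Rightarrow> ppoint) \<Rightarrow> bool" where
  "cocycle d \<alpha> \<longleftrightarrow> biregular 3 (fermat d) 3 (fermat d) \<alpha> \<and>
     (\<forall>p \<in> fermat d. (\<alpha> \<circ> pconj) ((\<alpha> \<circ> pconj) p) = p)"

definition quotient_by_cocycle :: "nat \<Rightarrow> (ppoint \<Rightarrow> ppoint) \<Rightarrow> real_var" where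
  "quotient_by_cocycle d \<alpha> = (fermat d, \<alpha> \<circ> pconj)"

definition corresponds :: "nat \<Rightarrow> complex mat \<Rightarrow> real_var \<Rightarrow> bool" where
  "corresponds d A R \<longleftrightarrow> cocycle d (lin_map A) \<and> real_variety 3 R \<and>
     real_isomorphic 3 R 3 (quotient_by_cocycle d (lin_map A))"

definition corresponds_eq :: "nat \<Rightarrow> complex mat \<Rightarrow> (complex vec \<Rightarrow> complex) \<Rightarrow> bool" where
  "corresponds_eq d A G \<longleftrightarrow> hom_form \<real> 3 d G \<and> corresponds d A (real_hypersurface 3 G)"

definition primitive_root_of_unity :: "nat \<Rightarrow> complex \<Rightarrow> bool" where
  "primitive_root_of_unity d \<xi> \<longleftrightarrow> 0 < d \<and> \<xi> ^ d = 1 \<and> (\<forall>k. 0 < k \<and> k < d \<longrightarrow> \<xi> ^ k \<noteq> 1)"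

definition J_mat :: "complex mat" where
  "J_mat = mat_of_rows_list 2 [[0, 1], [1, 0]]"

definition H_mat :: "nat \<Rightarrow> complex mat" where
  "H_mat r = diag_block_mat (1\<^sub>m r # replicate ((4 - r) div 2) J_mat)"

definition K_mat :: "complex \<Rightarrow> nat \<Rightarrow> nat \<Rightarrow> complex mat" where
  "K_mat \<xi> s t =
     diag_block_mat ([\<xi> \<cdot>\<^sub>m 1\<^sub>m s, 1\<^sub>m t] @ replicate ((4 - s - t) div 2) J_mat)"

definition L_mat :: "complex mat" where
  "L_mat = diag_block_mat (replicate 2 (mat_of_rows_list 2 [[0, 1], [-1, 0]]))"

definition Z_structure :: "ppoint \<Rightarrow> ppoint" where
  "Z_structure p = (\<lambda>z. vec_of_list [- cnj (z $ 1), cnj (z $ 0), - cnj (z $ 3), cnj (z $ 2)]) ` p"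

definition Z_var :: "nat \<Rightarrow> real_var" where
  "Z_var d = (fermat d, Z_structure)"

end

theory Submission
  imports Defs
begin

text \<open>
  If \<open>M\<close> is an invertible matrix and \<open>G\<close> a real form with \<open>G(v) = F(M v)\<close>, where \<open>F\<close> is the Fermat
  form, then \<open>M\<close> induces an isomorphism from \<open>(G = 0)\<close> to the Fermat surface that turns complex
  conjugation into \<open>A\<close> after conjugation, where \<open>A\<close> is \<open>M\<close> times the inverse of the conjugate of \<open>M\<close>. For the
  block \<open>J\<close> one takes the block of \<open>M\<close> with rows \<open>(1, \<i>)\<close> and \<open>(1, -\<i>)\<close>. For an entry \<open>\<xi>\<close> one takes
  a square root \<open>\<eta>\<close> of \<open>\<xi>\<close>: since \<open>\<eta>\<close> lies on the unit circle, \<open>\<eta> / cnj \<eta> = \<xi>\<close>, and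
  \<open>\<eta> ^ d = -1\<close> for even \<open>d\<close> because \<open>\<xi>\<close> is primitive; this is the origin of the minus signs. Finally,
  \<open>L\<close> after conjugation and the real structure of \<open>Z\<close> differ only by the scalar \<open>-1\<close>.
\<close>

section \<open>Forms\<close>

lemma hom_form_cong:
  assumes "hom_form K n k G" and "\<And>v. v \<in> carrier_vec (n + 1) \<Longrightarrow> H v = G v"
  shows "hom_form K n k H"
proof -
  obtain c where "range c \<subseteq> K" "\<forall>v \<in> carrier_vec (n + 1). G v =
      (\<Sum>a \<in> {a \<in> {..n} \<rightarrow>\<^sub>E {..k}. (\<Sum>i\<le>n. a i) = k}. c a * (\<Prod>i\<le>n. (v $ i) ^ a i))"
    using assms(1) unfolding hom_form_def by blast
  then show ?thesis
    unfolding hom_form_def using assms(2) by (intro exI[of _ c]) simp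
qed

lemma hom_form_mono:
  assumes "hom_form K n k G" and "K \<subseteq> L"
  shows "hom_form L n k G"
  using assms unfolding hom_form_def by blast

lemma hom_form_zero:
  assumes "0 \<in> K"
  shows "hom_form K n k (\<lambda>v. 0)"
  unfolding hom_form_def using assms by (intro exI[of _ "\<lambda>_. 0"]) auto

lemma hom_form_const:
  assumes "x \<in> K"
  shows "hom_form K n 0 (\<lambda>v. x)"
proof -
  \<comment> \<open>In degree 0 the only exponent vector is zero on \<open>{..n}\<close>;
    \<open>restrict\<close> makes it undefined elsewhere, as \<open>PiE\<close> demands.\<close>
  have "{a \<in> {..n} \<rightarrow>\<^sub>E {..0}. (\<Sum>i\<le>n. a i) = 0} = {restrict (\<lambda>_. 0 :: nat) {..n}}"
    by (auto simp: PiE_iff extensional_def restrict_def fun_eq_iff)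
  then show ?thesis
    unfolding hom_form_def using assms by (intro exI[of _ "\<lambda>_. x"]) auto
qed

text \<open>\<open>K\<close> is just a set of complex numbers, so closure under the operation enters
  as a premise. The two instances of interest are the reals, for equations of real varieties, and
  \<open>UNIV\<close>, for regular maps.\<close>

lemma hom_form_add:
  assumes "hom_form K n k G" and "hom_form K n k H"
    and closed: "\<And>x y. x \<in> K \<Longrightarrow> y \<in> K \<Longrightarrow> x + y \<in> K"
  shows "hom_form K n k (\<lambda>v. G v + H v)"
proof -
  obtain c where c: "range c \<subseteq> K" "\<forall>v \<in> carrier_vec (n + 1). G v =
      (\<Sum>a \<in> {a \<in> {..n} \<rightarrow>\<^sub>E {..k}. (\<Sum>i\<le>n. a i) = k}. c a * (\<Prod>i\<le>n. (v $ i) ^ a i))"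
    using assms(1) unfolding hom_form_def by blast
  obtain e where e: "range e \<subseteq> K" "\<forall>v \<in> carrier_vec (n + 1). H v =
      (\<Sum>a \<in> {a \<in> {..n} \<rightarrow>\<^sub>E {..k}. (\<Sum>i\<le>n. a i) = k}. e a * (\<Prod>i\<le>n. (v $ i) ^ a i))"
    using assms(2) unfolding hom_form_def by blast
  show ?thesis
    unfolding hom_form_def using c e closed
    by (intro exI[of _ "\<lambda>a. c a + e a"]) (auto simp: distrib_right sum.distrib image_subset_iff)
qed

lemma hom_form_smult:
  assumes "hom_form K n k G" and "x \<in> K"
    and closed: "\<And>x y. x \<in> K \<Longrightarrow> y \<in> K \<Longrightarrow> x * y \<in> K"
  shows "hom_form K n k (\<lambda>v. x * G v)"
proof -
  obtain c where c: "range c \<subseteq> K" "\<forall>v \<in> carrier_vec (n + 1). G v =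
      (\<Sum>a \<in> {a \<in> {..n} \<rightarrow>\<^sub>E {..k}. (\<Sum>i\<le>n. a i) = k}. c a * (\<Prod>i\<le>n. (v $ i) ^ a i))"
    using assms(1) unfolding hom_form_def by blast
  show ?thesis
    unfolding hom_form_def using c assms(2) closed
    by (intro exI[of _ "\<lambda>a. x * c a"]) (auto simp: sum_distrib_left mult.assoc image_subset_iff)
qed

lemma hom_form_sum:
  assumes "finite I" and "\<And>i. i \<in> I \<Longrightarrow> hom_form K n k (G i)" and "0 \<in> K"
    and closed: "\<And>x y. x \<in> K \<Longrightarrow> y \<in> K \<Longrightarrow> x + y \<in> K"
  shows "hom_form K n k (\<lambda>v. \<Sum>i\<in>I. G i v)"
  using assms(1,2)
proof (induction I rule: finite_induct)
  case empty
  then show ?case using hom_form_zero[OF assms(3)] by simp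
next
  case (insert i I)
  then show ?case by (simp add: hom_form_add closed)
qed

text \<open>Raising the \<open>i\<close>-th exponent by one is a bijection from the exponent vectors
  of degree \<open>k\<close> onto those of degree \<open>Suc k\<close> whose \<open>i\<close>-th
  exponent is positive. Together with sums and scalar multiples this yields every form below without
  expanding powers.\<close>

lemma hom_form_mult_coord:
  assumes "hom_form K n k G" and i: "i \<le> n" and "0 \<in> K"
  shows "hom_form K n (Suc k) (\<lambda>v. v $ i * G v)"
proof -
  let ?E = "\<lambda>k. {a \<in> {..n} \<rightarrow>\<^sub>E {..k}. (\<Sum>i\<le>n. a i) = k}"
  obtain c where c: "range c \<subseteq> K" "\<forall>v \<in> carrier_vec (n + 1). G v =
      (\<Sum>a \<in> ?E k. c a * (\<Prod>i\<le>n. (v $ i) ^ a i))"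
    using assms(1) unfolding hom_form_def by blast
  \<comment> \<open>The coefficients are shifted along the bijection. A monomial without the
    \<open>i\<close>-th variable gets coefficient 0, which is where \<open>0 \<in> K\<close>
    enters.\<close>
  define e where "e b = (if b i > 0 then c (b(i := b i - 1)) else 0)" for b
  \<comment> \<open>Each exponent is bounded by the total degree, so the range condition in
    \<open>PiE\<close> follows from the sum condition, and only the support and the degree have to
    be tracked.\<close>
  have E: "a \<in> ?E m \<longleftrightarrow> a \<in> extensional {..n} \<and> (\<Sum>i\<le>n. a i) = m" for a :: "nat \<Rightarrow> nat" and m
    by (auto simp: PiE_iff member_le_sum[of _ "{..n}" a])
  have S: "(\<Sum>j\<le>n. a j) = a i + (\<Sum>j\<in>{..n} - {i}. a j)" for a :: "nat \<Rightarrow> nat"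
    using i by (simp add: sum.remove)
  have U: "(\<Sum>j\<in>{..n} - {i}. (a(i := x)) j) = (\<Sum>j\<in>{..n} - {i}. a j)" for a :: "nat \<Rightarrow> nat" and x
    by (rule sum.cong) auto
  have up: "a(i := Suc (a i)) \<in> {b \<in> ?E (Suc k). b i > 0}" if "a \<in> ?E k" for a
  proof -
    have "a(i := Suc (a i)) \<in> ?E (Suc k)"
      using that i unfolding E S[of "a(i := Suc (a i))"] S[of a] U by (simp add: extensional_def)
    then show ?thesis by simp
  qed
  have down: "b(i := b i - 1) \<in> ?E k" if "b \<in> {b \<in> ?E (Suc k). b i > 0}" for b
  proof -
    have "b \<in> ?E (Suc k)" and "b i > 0"
      using that by blast+
    then show ?thesis
      using i unfolding E S[of "b(i := b i - 1)"] S[of b] U by (simp add: extensional_def)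
  qed
  have fin: "finite (?E m)" for m :: nat
    by (rule finite_subset[of _ "{..n} \<rightarrow>\<^sub>E {..m}"]) (auto intro!: finite_PiE)
  have "v $ i * G v = (\<Sum>b \<in> ?E (Suc k). e b * (\<Prod>i\<le>n. (v $ i) ^ b i))"
    if v: "v \<in> carrier_vec (n + 1)" for v
  proof -
    have P: "(\<Prod>j\<le>n. (v $ j) ^ (a(i := Suc (a i))) j) = v $ i * (\<Prod>j\<le>n. (v $ j) ^ a j)" for a
    proof -
      have "(\<Prod>j\<in>{..n} - {i}. (v $ j) ^ (a(i := Suc (a i))) j) = (\<Prod>j\<in>{..n} - {i}. (v $ j) ^ a j)"
        by (rule prod.cong) auto
      then show ?thesis
        using i prod.remove[of "{..n}" i "\<lambda>j. (v $ j) ^ (a(i := Suc (a i))) j"]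
          prod.remove[of "{..n}" i "\<lambda>j. (v $ j) ^ a j"] by simp
    qed
    have "(\<Sum>b \<in> ?E (Suc k). e b * (\<Prod>i\<le>n. (v $ i) ^ b i)) =
        (\<Sum>b \<in> {b \<in> ?E (Suc k). b i > 0}. e b * (\<Prod>i\<le>n. (v $ i) ^ b i))"
      using fin[of "Suc k"] by (intro sum.mono_neutral_right) (auto simp: e_def)
    also have "\<dots> = (\<Sum>a \<in> ?E k. v $ i * (c a * (\<Prod>i\<le>n. (v $ i) ^ a i)))"
    proof (rule sum.reindex_bij_witness[where i = "\<lambda>a. a(i := Suc (a i))" and j = "\<lambda>b. b(i := b i - 1)"])
      show "v $ i * (c (b(i := b i - 1)) * (\<Prod>j\<le>n. (v $ j) ^ (b(i := b i - 1)) j)) =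
          e b * (\<Prod>j\<le>n. (v $ j) ^ b j)" if "b \<in> {b \<in> ?E (Suc k). b i > 0}" for b
      proof -
        have "b i > 0" using that by blast
        then show ?thesis
          using P[of "b(i := b i - 1)"] by (simp add: e_def mult.left_commute)
      qed
      show "(b(i := b i - 1))(i := Suc ((b(i := b i - 1)) i)) = b" if "b \<in> {b \<in> ?E (Suc k). b i > 0}" for b
      proof -
        have "b i > 0" using that by blast
        then show ?thesis by simp
      qed
      show "(a(i := Suc (a i)))(i := (a(i := Suc (a i))) i - 1) = a" for a :: "nat \<Rightarrow> nat"
        by simp
    qed (fact up down)+
    also have "\<dots> = v $ i * G v"
      using c(2) v by (simp add: sum_distrib_left)
    finally show ?thesis by (rule sym)
  qed
  moreover have "range e \<subseteq> K"
    using c(1) assms(3) by (auto simp: e_def)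
  ultimately show ?thesis
    unfolding hom_form_def by blast
qed

lemma hom_form_coord:
  assumes "i \<le> n" and "0 \<in> K" and "1 \<in> K"
  shows "hom_form K n 1 (\<lambda>v. v $ i)"
  using hom_form_mult_coord[OF hom_form_const[OF assms(3)] assms(1,2)] by simp

lemma hom_form_coord_power:
  assumes "i \<le> n" and "0 \<in> K" and "1 \<in> K"
  shows "hom_form K n k (\<lambda>v. (v $ i) ^ k)"
proof (induction k)
  case 0
  then show ?case using hom_form_const[OF assms(3)] by simp
next
  case (Suc k)
  then show ?case using hom_form_mult_coord[OF Suc assms(1,2)] by simp
qed

text \<open>The sum is twice the real part of the first power, computed as if the coordinates were real.\<close>

lemma hom_form_conjugate_powers:
  assumes "i \<le> n" and "j \<le> n"
  shows "hom_form \<real> n k (\<lambda>v. (v $ i + \<i> * v $ j) ^ k + (v $ i - \<i> * v $ j) ^ k)"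
proof -
  have "\<exists>R I. hom_form \<real> n k R \<and> hom_form \<real> n k I \<and>
    (\<forall>v. (v $ i + \<i> * v $ j) ^ k = R v + \<i> * I v \<and> (v $ i - \<i> * v $ j) ^ k = R v - \<i> * I v)"
  proof (induction k)
    case 0
    show ?case
      by (rule exI[of _ "\<lambda>_. 1"], rule exI[of _ "\<lambda>_. 0"]) (simp add: hom_form_const hom_form_zero)
  next
    case (Suc k)
    then obtain R I where RI: "hom_form \<real> n k R" "hom_form \<real> n k I"
      "\<And>v. (v $ i + \<i> * v $ j) ^ k = R v + \<i> * I v"
      "\<And>v. (v $ i - \<i> * v $ j) ^ k = R v - \<i> * I v"
      by blast
    \<comment> \<open>The new pair consists of the real and imaginary parts of the product of
      \<open>v $ i + \<i> * v $ j\<close> with \<open>R v + \<i> * I v\<close>, read off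
      formally.\<close>
    have "hom_form \<real> n (Suc k) (\<lambda>v. v $ i * R v + (-1) * (v $ j * I v))"
      using RI(1,2) assms by (intro hom_form_add hom_form_smult hom_form_mult_coord) auto
    moreover have "hom_form \<real> n (Suc k) (\<lambda>v. v $ i * I v + v $ j * R v)"
      using RI(1,2) assms by (intro hom_form_add hom_form_mult_coord) auto
    ultimately show ?case
      by (intro exI[of _ "\<lambda>v. v $ i * R v + (-1) * (v $ j * I v)"]
          exI[of _ "\<lambda>v. v $ i * I v + v $ j * R v"]) (simp add: RI(3,4) algebra_simps)
  qed
  then obtain R I where RI: "hom_form \<real> n k R"
    "\<And>v. (v $ i + \<i> * v $ j) ^ k = R v + \<i> * I v"
    "\<And>v. (v $ i - \<i> * v $ j) ^ k = R v - \<i> * I v"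
    by blast
  have "hom_form \<real> n k (\<lambda>v. R v + R v)"
    using RI(1) by (intro hom_form_add) auto
  then show ?thesis
    by (simp add: RI(2,3))
qed

section \<open>Behaviour of forms under scaling and complex conjugation\<close>

lemma hom_form_smult_vec:
  assumes "hom_form K n k G" and "v \<in> carrier_vec (n + 1)"
  shows "G (x \<cdot>\<^sub>v v) = x ^ k * G v"
proof -
  obtain c where c: "\<And>v. v \<in> carrier_vec (n + 1) \<Longrightarrow> G v =
      (\<Sum>a \<in> {a \<in> {..n} \<rightarrow>\<^sub>E {..k}. (\<Sum>i\<le>n. a i) = k}. c a * (\<Prod>i\<le>n. (v $ i) ^ a i))"
    using assms(1) unfolding hom_form_def by blast
  have "(\<Prod>i\<le>n. ((x \<cdot>\<^sub>v v) $ i) ^ a i) = x ^ (\<Sum>i\<le>n. a i) * (\<Prod>i\<le>n. (v $ i) ^ a i)" for a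
    using assms(2) by (simp add: power_mult_distrib prod.distrib power_sum)
  then show ?thesis
    using assms(2) by (simp add: c sum_distrib_left algebra_simps)
qed

text \<open>Conjugation fixes the real coefficients and commutes with sums and products. This makes
  real hypersurfaces stable under \<open>pconj\<close>.\<close>

lemma hom_form_conjugate:
  assumes "hom_form \<real> n k G" and "v \<in> carrier_vec (n + 1)"
  shows "G (conjugate v) = cnj (G v)"
proof -
  obtain c where "range c \<subseteq> \<real>" and c: "\<And>v. v \<in> carrier_vec (n + 1) \<Longrightarrow> G v =
      (\<Sum>a \<in> {a \<in> {..n} \<rightarrow>\<^sub>E {..k}. (\<Sum>i\<le>n. a i) = k}. c a * (\<Prod>i\<le>n. (v $ i) ^ a i))"
    using assms(1) unfolding hom_form_def by blast
  then have "cnj (c a) = c a" for a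
    using Reals_cnj_iff[of "c a"] by blast
  then show ?thesis
    using assms(2) by (simp add: c)
qed

section \<open>Linear maps of projective space\<close>

lemma lin_map_ppoint:
  assumes "A \<in> carrier_mat m n" and "v \<in> carrier_vec n"
  shows "lin_map A (ppoint v) = ppoint (A *\<^sub>v v)"
proof -
  have "lin_map A (ppoint v) = (\<lambda>c. A *\<^sub>v (c \<cdot>\<^sub>v v)) ` {c. c \<noteq> 0}"
    unfolding lin_map_def ppoint_def by auto
  then show ?thesis
    using assms by (auto simp: ppoint_def mult_mat_vec)
qed

lemma pconj_ppoint: "pconj (ppoint v) = ppoint (conjugate v)"
proof -
  have "\<exists>c. c \<cdot>\<^sub>v conjugate v = conjugate (d \<cdot>\<^sub>v v) \<and> c \<noteq> 0" if "d \<noteq> 0" for d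
    using that by (intro exI[of _ "cnj d"]) (simp add: conjugate_smult_vec)
  moreover have "\<exists>c. conjugate (c \<cdot>\<^sub>v v) = d \<cdot>\<^sub>v conjugate v \<and> c \<noteq> 0" if "d \<noteq> 0" for d
    using that by (intro exI[of _ "cnj d"]) (simp add: conjugate_smult_vec)
  ultimately show ?thesis
    unfolding pconj_def ppoint_def image_def by (auto, metis+)
qed

lemma ppoint_smult:
  assumes "c \<noteq> 0"
  shows "ppoint (c \<cdot>\<^sub>v v) = ppoint v"
proof -
  have "\<exists>e. e \<cdot>\<^sub>v (c \<cdot>\<^sub>v v) = d \<cdot>\<^sub>v v \<and> e \<noteq> 0" if "d \<noteq> 0" for d
    using assms that by (intro exI[of _ "d / c"]) (simp add: smult_smult_assoc)
  moreover have "\<exists>e. e \<cdot>\<^sub>v v = d \<cdot>\<^sub>v (c \<cdot>\<^sub>v v) \<and> e \<noteq> 0" if "d \<noteq> 0" for d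
    using assms that by (intro exI[of _ "d * c"]) (simp add: smult_smult_assoc)
  ultimately show ?thesis
    unfolding ppoint_def by (auto, metis+)
qed

lemma smult_vec_eq_zero_iff:
  fixes v :: "'a :: field vec"
  assumes "v \<in> carrier_vec n" and "c \<noteq> 0"
  shows "c \<cdot>\<^sub>v v = 0\<^sub>v n \<longleftrightarrow> v = 0\<^sub>v n"
proof (intro iffI)
  assume "c \<cdot>\<^sub>v v = 0\<^sub>v n"
  then have "inverse c \<cdot>\<^sub>v (c \<cdot>\<^sub>v v) = 0\<^sub>v n" by auto
  then show "v = 0\<^sub>v n" using assms(2) by (simp add: smult_smult_assoc)
qed auto

lemma smult_one_mult_mat_vec:
  fixes v :: "'a :: comm_semiring_1 vec"
  assumes "v \<in> carrier_vec n"
  shows "(b \<cdot>\<^sub>m 1\<^sub>m n) *\<^sub>v v = b \<cdot>\<^sub>v v"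
  using assms by (intro eq_vecI) auto

lemma ppoint_self: "v \<in> ppoint v"
  unfolding ppoint_def by (auto intro!: exI[of _ 1])

lemma ppoint_cases:
  assumes "p \<in> proj_space n"
  obtains v where "v \<in> carrier_vec (n + 1)" "v \<noteq> 0\<^sub>v (n + 1)" "p = ppoint v"
  using assms unfolding proj_space_def by auto

lemma ppoint_representative:
  assumes "p \<in> proj_space n" and "v \<in> p"
  shows "v \<in> carrier_vec (n + 1)" "v \<noteq> 0\<^sub>v (n + 1)" "p = ppoint v"
proof -
  obtain w where w: "w \<in> carrier_vec (n + 1)" "w \<noteq> 0\<^sub>v (n + 1)" "p = ppoint w"
    using assms(1) by (rule ppoint_cases)
  then obtain c where c: "c \<noteq> 0" "v = c \<cdot>\<^sub>v w"
    using assms(2) unfolding ppoint_def by auto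
  show "v \<in> carrier_vec (n + 1)" "v \<noteq> 0\<^sub>v (n + 1)" "p = ppoint v"
    using w c smult_vec_eq_zero_iff[OF w(1) c(1)] by (simp_all add: ppoint_smult)
qed

text \<open>By homogeneity a form vanishes on all representatives of a point as soon as it vanishes
  on one, so membership can be tested on a single nonzero vector.\<close>

lemma ppoint_in_proj_zeros_iff:
  assumes "hom_form K n k G" and "v \<in> carrier_vec (n + 1)"
  shows "ppoint v \<in> proj_zeros n G \<longleftrightarrow> v \<noteq> 0\<^sub>v (n + 1) \<and> G v = 0"
proof -
  have "ppoint v \<in> proj_space n \<longleftrightarrow> v \<noteq> 0\<^sub>v (n + 1)"
    using assms(2) ppoint_representative(2)[OF _ ppoint_self] unfolding proj_space_def by blast
  moreover have "(\<forall>w \<in> ppoint v. G w = 0) \<longleftrightarrow> G v = 0"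
    using ppoint_self hom_form_smult_vec[OF assms] unfolding ppoint_def by fastforce
  ultimately show ?thesis
    unfolding proj_zeros_def by simp
qed

lemma proj_zeros_subset: "proj_zeros n G \<subseteq> proj_space n"
  unfolding proj_zeros_def by blast

lemma zariski_closed_proj_zeros:
  assumes "hom_form K n k G"
  shows "zariski_closed n (proj_zeros n G)"
  unfolding zariski_closed_def using hom_form_mono[OF assms subset_UNIV]
  by (intro exI[of _ "{G}"]) (auto simp: proj_zeros_def)

section \<open>Regular and biregular maps induced by invertible matrices\<close>

lemma hom_form_mult_mat_vec:
  assumes A: "A \<in> carrier_mat (m + 1) (n + 1)" and "i \<le> m"
  shows "hom_form UNIV n 1 (\<lambda>v. (A *\<^sub>v v) $ i)"
proof (rule hom_form_cong)
  show "hom_form UNIV n 1 (\<lambda>v. \<Sum>j\<in>{0..<n + 1}. A $$ (i, j) * v $ j)"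
    by (intro hom_form_sum hom_form_smult hom_form_coord) auto
  show "(A *\<^sub>v v) $ i = (\<Sum>j\<in>{0..<n + 1}. A $$ (i, j) * v $ j)" if "v \<in> carrier_vec (n + 1)" for v
    using A \<open>i \<le> m\<close> that by (auto simp: scalar_prod_def intro!: sum.cong)
qed

text \<open>A left inverse up to a nonzero scalar suffices for injectivity. Inverses are taken up to
  a scalar throughout because scalars act trivially on points, and because \<open>L_mat\<close>
  times its conjugate is minus the identity.\<close>

lemma mult_mat_vec_nonzero:
  fixes A :: "'a :: field mat"
  assumes "A \<in> carrier_mat n n" "B \<in> carrier_mat n n" "B * A = b \<cdot>\<^sub>m 1\<^sub>m n" "b \<noteq> 0"
    and "v \<in> carrier_vec n" "v \<noteq> 0\<^sub>v n"
  shows "A *\<^sub>v v \<noteq> 0\<^sub>v n"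
proof
  assume zero: "A *\<^sub>v v = 0\<^sub>v n"
  have "b \<cdot>\<^sub>v v = (B * A) *\<^sub>v v"
    unfolding assms(3) by (rule smult_one_mult_mat_vec[OF assms(5), symmetric])
  also have "\<dots> = B *\<^sub>v (A *\<^sub>v v)"
    by (rule assoc_mult_mat_vec[OF assms(2,1,5)])
  also have "\<dots> = 0\<^sub>v n"
    unfolding zero by (rule eq_vecI) (use assms(2) in \<open>simp_all\<close>)
  finally show False
    using assms(6) by (simp only: smult_vec_eq_zero_iff[OF assms(5,4)])
qed

text \<open>The rows of \<open>A\<close> are linear forms, and they have no common zero on
  projective space since \<open>B * A\<close> is a nonzero scalar; hence one family of forms serves
  at every point. The map \<open>f\<close> has to agree with \<open>lin_map A\<close> on
  \<open>X\<close> only, which admits composites that are linear merely after restriction.\<close>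

lemma regular_map_lin_map:
  assumes A: "A \<in> carrier_mat (n + 1) (n + 1)" and B: "B \<in> carrier_mat (n + 1) (n + 1)"
    and BA: "B * A = b \<cdot>\<^sub>m 1\<^sub>m (n + 1)" "b \<noteq> 0"
    and X: "X \<subseteq> proj_space n" and img: "lin_map A ` X \<subseteq> Y"
    and f: "\<And>p. p \<in> X \<Longrightarrow> f p = lin_map A p"
  shows "regular_map n X n Y f"
  unfolding regular_map_def
proof (intro conjI ballI)
  show "f ` X \<subseteq> Y"
    using img f by auto
  fix p assume p: "p \<in> X"
  then obtain v where v: "v \<in> carrier_vec (n + 1)" "v \<noteq> 0\<^sub>v (n + 1)" "p = ppoint v"
    using X ppoint_cases by blast
  have Av: "A *\<^sub>v v \<noteq> 0\<^sub>v (n + 1)"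
    using mult_mat_vec_nonzero[OF A B BA v(1,2)] .
  show "\<exists>k P. (\<forall>j\<le>n. hom_form UNIV n k (P j)) \<and> (\<exists>v \<in> p. \<exists>j\<le>n. P j v \<noteq> 0) \<and>
    (\<forall>q \<in> X. \<forall>v \<in> q. (\<exists>j\<le>n. P j v \<noteq> 0) \<longrightarrow> f q = ppoint (vec (n + 1) (\<lambda>j. P j v)))"
  proof (intro exI conjI allI impI ballI)
    show "hom_form UNIV n 1 (\<lambda>v. (A *\<^sub>v v) $ j)" if "j \<le> n" for j
      using hom_form_mult_mat_vec[OF A that] .
    show "\<exists>v \<in> p. \<exists>j\<le>n. (A *\<^sub>v v) $ j \<noteq> 0"
    proof (rule ccontr)
      assume "\<not> ?thesis"
      then have "(A *\<^sub>v v) $ j = 0" if "j \<le> n" for j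
        using v(3) ppoint_self that by blast
      then have "A *\<^sub>v v = 0\<^sub>v (n + 1)"
        using A by (intro eq_vecI) (auto simp del: index_mult_mat_vec)
      then show False using Av by simp
    qed
    fix q w assume q: "q \<in> X" and w: "w \<in> q"
    note w' = ppoint_representative[OF subsetD[OF X q] w]
    have "vec (n + 1) (\<lambda>j. (A *\<^sub>v w) $ j) = A *\<^sub>v w"
      using A by (intro eq_vecI) auto
    then show "f q = ppoint (vec (n + 1) (\<lambda>j. (A *\<^sub>v w) $ j))"
      using w' q lin_map_ppoint[OF A w'(1)] f by simp
  qed
qed

lemma lin_map_scalar_inverse:
  assumes "A \<in> carrier_mat (n + 1) (n + 1)" "B \<in> carrier_mat (n + 1) (n + 1)"
    and "B * A = b \<cdot>\<^sub>m 1\<^sub>m (n + 1)" "b \<noteq> 0" and "p \<in> proj_space n"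
  shows "lin_map B (lin_map A p) = p"
proof -
  obtain v where v: "v \<in> carrier_vec (n + 1)" "p = ppoint v"
    using assms(5) by (rule ppoint_cases)
  have "B *\<^sub>v (A *\<^sub>v v) = b \<cdot>\<^sub>v v"
    using v(1) assms assoc_mult_mat_vec[of B "n + 1" "n + 1" A "n + 1" v]
    by (simp add: smult_one_mult_mat_vec)
  then show ?thesis
    using v assms(1,2,4) lin_map_ppoint[OF assms(1) v(1)] lin_map_ppoint[OF assms(2), of "A *\<^sub>v v"]
    by (simp add: ppoint_smult)
qed

lemma biregular_lin_map:
  assumes A: "A \<in> carrier_mat (n + 1) (n + 1)" and B: "B \<in> carrier_mat (n + 1) (n + 1)"
    and AB: "A * B = a \<cdot>\<^sub>m 1\<^sub>m (n + 1)" "a \<noteq> 0" and BA: "B * A = b \<cdot>\<^sub>m 1\<^sub>m (n + 1)" "b \<noteq> 0"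
    and X: "X \<subseteq> proj_space n" and Y: "Y \<subseteq> proj_space n"
    and "lin_map A ` X \<subseteq> Y" and "lin_map B ` Y \<subseteq> X"
  shows "biregular n X n Y (lin_map A)"
  unfolding biregular_def
proof (intro conjI exI ballI)
  show "regular_map n X n Y (lin_map A)"
    by (rule regular_map_lin_map[OF A B BA X]) (use assms in auto)
  show "regular_map n Y n X (lin_map B)"
    by (rule regular_map_lin_map[OF B A AB Y]) (use assms in auto)
  show "lin_map B (lin_map A p) = p" if "p \<in> X" for p
    using lin_map_scalar_inverse[OF A B BA] that X by blast
  show "lin_map A (lin_map B q) = q" if "q \<in> Y" for q
    using lin_map_scalar_inverse[OF B A AB] that Y by blast
qed

section \<open>Real forms given by conjugate matrices\<close>

lemma conjugate_mult_mat_vec: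
  assumes "A \<in> carrier_mat m n" and "v \<in> carrier_vec n"
  shows "conjugate (A *\<^sub>v v) = map_mat cnj A *\<^sub>v conjugate v"
  using assms by (intro eq_vecI) (auto simp: scalar_prod_def intro!: sum.cong)

lemma map_mat_cnj_mult:
  assumes "A \<in> carrier_mat m n" and "B \<in> carrier_mat n k"
  shows "map_mat cnj (A * B) = map_mat cnj A * map_mat cnj B"
  using assms by (intro eq_matI) (auto simp: scalar_prod_def intro!: sum.cong)

lemma map_mat_cnj_map_mat_cnj: "map_mat cnj (map_mat cnj A) = A"
  by (intro eq_matI) auto

lemma pconj_pconj: "p \<in> proj_space n \<Longrightarrow> pconj (pconj p) = p"
  by (erule ppoint_cases) (simp add: pconj_ppoint)

lemma lin_map_one: "p \<in> proj_space n \<Longrightarrow> lin_map (1\<^sub>m (n + 1)) p = p"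
  by (erule ppoint_cases) (simp add: lin_map_ppoint[of _ "n + 1" "n + 1"])

lemma regular_map_id:
  assumes "X \<subseteq> proj_space n" and "X \<subseteq> Y" and "\<And>p. p \<in> X \<Longrightarrow> f p = p"
  shows "regular_map n X n Y f"
proof (rule regular_map_lin_map[of "1\<^sub>m (n + 1)" n "1\<^sub>m (n + 1)" 1])
  have one: "lin_map (1\<^sub>m (n + 1)) p = p" if "p \<in> X" for p
    using assms(1) that lin_map_one by blast
  then show "lin_map (1\<^sub>m (n + 1)) ` X \<subseteq> Y"
    using assms(2) by auto
  show "f p = lin_map (1\<^sub>m (n + 1)) p" if "p \<in> X" for p
    using assms(3) one that by simp
qed (use assms(1) in auto)

lemma proj_zeros_cases:
  assumes "p \<in> proj_zeros n G"
  obtains v where "v \<in> carrier_vec (n + 1)" "v \<noteq> 0\<^sub>v (n + 1)" "G v = 0" "p = ppoint v"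
proof -
  obtain v where "v \<in> carrier_vec (n + 1)" "v \<noteq> 0\<^sub>v (n + 1)" "p = ppoint v"
    using assms ppoint_cases unfolding proj_zeros_def by blast
  moreover have "G v = 0"
    using assms calculation(3) ppoint_self unfolding proj_zeros_def by blast
  ultimately show ?thesis
    using that by blast
qed

lemma lin_map_proj_zeros_subset:
  assumes G: "hom_form K n k G" and H: "hom_form L n l H"
    and A: "A \<in> carrier_mat (n + 1) (n + 1)" and B: "B \<in> carrier_mat (n + 1) (n + 1)"
    and BA: "B * A = b \<cdot>\<^sub>m 1\<^sub>m (n + 1)" "b \<noteq> 0"
    and "\<And>v. v \<in> carrier_vec (n + 1) \<Longrightarrow> G v = 0 \<Longrightarrow> H (A *\<^sub>v v) = 0"
  shows "lin_map A ` proj_zeros n G \<subseteq> proj_zeros n H"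
proof
  fix q assume "q \<in> lin_map A ` proj_zeros n G"
  then obtain p where "p \<in> proj_zeros n G" "q = lin_map A p" by blast
  then obtain v where v: "v \<in> carrier_vec (n + 1)" "v \<noteq> 0\<^sub>v (n + 1)" "G v = 0" "q = lin_map A (ppoint v)"
    by (elim proj_zeros_cases) auto
  then show "q \<in> proj_zeros n H"
    using assms(7)[OF v(1,3)] mult_mat_vec_nonzero[OF A B BA v(1,2)] A
    by (simp add: lin_map_ppoint[OF A] ppoint_in_proj_zeros_iff[OF H] del: One_nat_def add_Suc_right)
qed

lemma pconj_proj_zeros:
  assumes "hom_form \<real> n k G"
  shows "pconj ` proj_zeros n G = proj_zeros n G"
proof -
  have sub: "pconj p \<in> proj_zeros n G" if "p \<in> proj_zeros n G" for p
    using that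
  proof (rule proj_zeros_cases)
    fix v assume v: "v \<in> carrier_vec (n + 1)" "v \<noteq> 0\<^sub>v (n + 1)" "G v = 0" "p = ppoint v"
    then show ?thesis
      using hom_form_conjugate[OF assms v(1)] carrier_vec_conjugate[OF v(1)]
      by (simp add: pconj_ppoint ppoint_in_proj_zeros_iff[OF assms])
  qed
  have "p \<in> pconj ` proj_zeros n G" if "p \<in> proj_zeros n G" for p
    using sub[OF that] that pconj_pconj[of p n] proj_zeros_subset[of n G] by (metis imageI subsetD)
  then show ?thesis
    using sub by blast
qed

text \<open>Antiregularity of \<open>pconj\<close> means regularity of
  \<open>pconj \<circ> pconj\<close> as a map to the conjugate variety. That composite is the
  identity on points, and a hypersurface with real equation is its own conjugate.\<close>

lemma real_variety_real_hypersurface: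
  assumes "hom_form \<real> n k G"
  shows "real_variety n (real_hypersurface n G)"
  unfolding real_variety_def real_structure_def real_hypersurface_def fst_conv snd_conv
    pconj_proj_zeros[OF assms]
proof (intro conjI ballI)
  show "zariski_closed n (proj_zeros n G)"
    by (rule zariski_closed_proj_zeros[OF assms])
  show "regular_map n (proj_zeros n G) n (proj_zeros n G) (pconj \<circ> pconj)"
    by (rule regular_map_id) (use proj_zeros_subset[of n G] in \<open>auto simp: pconj_pconj\<close>)
qed (use proj_zeros_subset[of n G] pconj_pconj in auto)

section \<open>The Fermat form and linear cocycles\<close>

definition fermat_form :: "nat \<Rightarrow> complex vec \<Rightarrow> complex" where
  "fermat_form d x = (x $ 0) ^ d + (x $ 1) ^ d + (x $ 2) ^ d + (x $ 3) ^ d"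

lemma fermat_eq: "fermat d = proj_zeros 3 (fermat_form d)"
  unfolding fermat_def fermat_form_def ..

lemma hom_form_fermat: "hom_form \<real> 3 d (fermat_form d)"
  unfolding fermat_form_def by (intro hom_form_add hom_form_coord_power) auto

text \<open>The square of \<open>lin_map A \<circ> pconj\<close> is induced by
  \<open>A * map_mat cnj A\<close>, so it is the identity once this product is a nonzero scalar. The
  same relation provides the conjugate of \<open>A\<close> as inverse up to a scalar, which gives
  biregularity.\<close>

lemma cocycle_lin_map:
  assumes A: "A \<in> carrier_mat 4 4" and AA: "A * map_mat cnj A = c \<cdot>\<^sub>m 1\<^sub>m 4" "c \<noteq> 0"
    and inv: "\<And>v. v \<in> carrier_vec 4 \<Longrightarrow> fermat_form d v = 0 \<Longrightarrow> fermat_form d (A *\<^sub>v v) = 0"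
  shows "cocycle d (lin_map A)"
proof -
  let ?B = "map_mat cnj A"
  have A': "A \<in> carrier_mat (3 + 1) (3 + 1)" "?B \<in> carrier_mat (3 + 1) (3 + 1)"
    using A by auto
  \<comment> \<open>Conjugating the relation exchanges the two factors and so yields the inverse on
    the other side.\<close>
  have "map_mat cnj (A * ?B) = cnj c \<cdot>\<^sub>m 1\<^sub>m 4"
    unfolding AA by (intro eq_matI) auto
  then have BA: "?B * A = cnj c \<cdot>\<^sub>m 1\<^sub>m (3 + 1)" "cnj c \<noteq> 0"
    using A AA(2) by (simp_all add: map_mat_cnj_mult[of A 4 4] map_mat_cnj_map_mat_cnj)
  have AB: "A * ?B = c \<cdot>\<^sub>m 1\<^sub>m (3 + 1)"
    using AA by simp
  \<comment> \<open>The conjugate matrix is \<open>A\<close> conjugated by complex conjugation, and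
    the latter preserves the zeros of the Fermat form, whose coefficients are real.\<close>
  have inv': "fermat_form d (?B *\<^sub>v v) = 0" if v: "v \<in> carrier_vec 4" "fermat_form d v = 0" for v
  proof -
    have v': "conjugate v \<in> carrier_vec (3 + 1)" "v \<in> carrier_vec (3 + 1)"
      using v(1) by auto
    have "fermat_form d (conjugate v) = 0"
      using hom_form_conjugate[OF hom_form_fermat v'(2)] v(2) by simp
    then have "fermat_form d (A *\<^sub>v conjugate v) = 0"
      using inv v' by simp
    moreover have "?B *\<^sub>v v = conjugate (A *\<^sub>v conjugate v)"
      using A v(1) by (simp add: conjugate_mult_mat_vec[of A 4 4])
    ultimately show ?thesis
      using hom_form_conjugate[OF hom_form_fermat, of "A *\<^sub>v conjugate v"]
        mult_mat_vec_carrier[OF A'(1) v'(1)] by simp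
  qed
  have subA: "lin_map A ` fermat d \<subseteq> fermat d"
    unfolding fermat_eq
    by (rule lin_map_proj_zeros_subset[OF hom_form_fermat hom_form_fermat A' BA]) (use inv in simp)
  have subB: "lin_map ?B ` fermat d \<subseteq> fermat d"
    unfolding fermat_eq
    by (rule lin_map_proj_zeros_subset[OF hom_form_fermat hom_form_fermat A'(2,1) AB AA(2)])
      (use inv' in simp)
  have sub: "fermat d \<subseteq> proj_space 3"
    unfolding fermat_eq by (rule proj_zeros_subset)
  have "(lin_map A \<circ> pconj) ((lin_map A \<circ> pconj) p) = p" if "p \<in> fermat d" for p
  proof -
    have p: "p \<in> proj_space 3"
      using that sub by blast
    then obtain v where v: "v \<in> carrier_vec (3 + 1)" "p = ppoint v"
      by (rule ppoint_cases)
    have "pconj (lin_map A (pconj p)) = lin_map ?B p"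
      using v A by (simp add: pconj_ppoint lin_map_ppoint[of _ 4 4] conjugate_mult_mat_vec[of A 4 4])
    then show ?thesis
      using lin_map_scalar_inverse[OF A'(2,1) AB AA(2) p] by simp
  qed
  then show ?thesis
    unfolding cocycle_def using biregular_lin_map[OF A' AB AA(2) BA sub sub subA subB] by simp
qed

text \<open>The linear map \<open>M\<close> identifies the two complexifications, and the condition
  \<open>A * map_mat cnj M = M\<close> says that it carries \<open>pconj\<close> to \<open>lin_map A \<circ> pconj\<close>. It forces
  \<open>A = M * inverse (map_mat cnj M)\<close>, so the cocycle condition need not be assumed.\<close>

lemma corresponds_eq_lin_map:
  assumes A: "A \<in> carrier_mat 4 4" and M: "M \<in> carrier_mat 4 4" and N: "N \<in> carrier_mat 4 4"
    and MN: "M * N = 1\<^sub>m 4" and NM: "N * M = 1\<^sub>m 4"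
    and AM: "A * map_mat cnj M = M"
    and G: "hom_form \<real> 3 d G" and GM: "\<And>v. v \<in> carrier_vec 4 \<Longrightarrow> G v = fermat_form d (M *\<^sub>v v)"
  shows "corresponds_eq d A G"
proof -
  let ?cN = "map_mat cnj N" and ?cM = "map_mat cnj M"
  have cN: "?cN \<in> carrier_mat 4 4" and cM: "?cM \<in> carrier_mat 4 4"
    using M N by auto
  have cMN: "?cM * ?cN = 1\<^sub>m 4" "?cN * ?cM = 1\<^sub>m 4"
    using M N MN NM by (auto simp flip: map_mat_cnj_mult[of _ 4 4 _ 4] intro!: eq_matI)
  have A_eq: "A = M * ?cN"
    using A cM cN assoc_mult_mat[OF A cM cN] by (simp add: AM cMN)
  have "A * map_mat cnj A = M * ?cN * (?cM * N)"
    using M cN by (simp add: A_eq map_mat_cnj_mult[of M 4 4] map_mat_cnj_map_mat_cnj)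
  also have "\<dots> = M * (?cN * ?cM) * N"
    using M N cN cM by (simp add: assoc_mult_mat[of _ 4 4 _ 4 _ 4])
  also have "\<dots> = 1 \<cdot>\<^sub>m 1\<^sub>m 4"
    using M MN cMN by auto
  finally have AA: "A * map_mat cnj A = 1 \<cdot>\<^sub>m 1\<^sub>m 4" .
  have FG: "fermat_form d v = G (N *\<^sub>v v)" if "v \<in> carrier_vec 4" for v
    using that M N MN GM[of "N *\<^sub>v v"] by (simp flip: assoc_mult_mat_vec[of M 4 4 N 4])
  have "cocycle d (lin_map A)"
  proof (rule cocycle_lin_map[OF A AA])
    fix v :: "complex vec" assume v: "v \<in> carrier_vec 4" "fermat_form d v = 0"
    then have v': "v \<in> carrier_vec (3 + 1)" "conjugate v \<in> carrier_vec 4" "N *\<^sub>v conjugate v \<in> carrier_vec (3 + 1)"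
      using N by auto
    \<comment> \<open>From \<open>A = M * ?cN\<close> the value becomes one of \<open>G\<close>;
      reality of \<open>G\<close> and of the Fermat form then turns it into the conjugate of the
      Fermat form at \<open>conjugate v\<close>, hence into the Fermat form at
      \<open>v\<close>.\<close>
    have "fermat_form d (A *\<^sub>v v) = G (?cN *\<^sub>v v)"
      using v(1) M cN GM[of "?cN *\<^sub>v v"] by (simp add: A_eq)
    also have "\<dots> = G (conjugate (N *\<^sub>v conjugate v))"
      using v(1) N by (simp add: conjugate_mult_mat_vec[of N 4 4])
    also have "\<dots> = cnj (fermat_form d (conjugate v))"
      using hom_form_conjugate[OF G v'(3)] FG[OF v'(2)] by simp
    also have "\<dots> = 0"
      using hom_form_conjugate[OF hom_form_fermat v'(1)] v(2) by simp
    finally show "fermat_form d (A *\<^sub>v v) = 0" .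
  qed simp
  moreover have "real_isomorphic 3 (real_hypersurface 3 G) 3 (quotient_by_cocycle d (lin_map A))"
    unfolding real_isomorphic_def real_hypersurface_def quotient_by_cocycle_def fst_conv snd_conv
  proof (intro exI[of _ "lin_map M"] conjI ballI)
    have MN': "M \<in> carrier_mat (3 + 1) (3 + 1)" "N \<in> carrier_mat (3 + 1) (3 + 1)"
      "M * N = 1 \<cdot>\<^sub>m 1\<^sub>m (3 + 1)" "N * M = 1 \<cdot>\<^sub>m 1\<^sub>m (3 + 1)"
      using M N MN NM by auto
    show "biregular 3 (proj_zeros 3 G) 3 (fermat d) (lin_map M)"
      unfolding fermat_eq
    proof (rule biregular_lin_map[OF MN'(1-3) _ MN'(4)])
      show "lin_map M ` proj_zeros 3 G \<subseteq> proj_zeros 3 (fermat_form d)"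
        by (rule lin_map_proj_zeros_subset[OF G hom_form_fermat MN'(1,2,4)]) (use GM in auto)
      show "lin_map N ` proj_zeros 3 (fermat_form d) \<subseteq> proj_zeros 3 G"
        by (rule lin_map_proj_zeros_subset[OF hom_form_fermat G MN'(2,1,3)]) (use FG in auto)
    qed (auto simp: proj_zeros_subset)
    fix p assume "p \<in> proj_zeros 3 G"
    then obtain v where v: "v \<in> carrier_vec (3 + 1)" "p = ppoint v"
      by (rule proj_zeros_cases)
    \<comment> \<open>This is \<open>A * map_mat cnj M = M\<close> applied to
      \<open>conjugate v\<close>: on vectors, \<open>M\<close> intertwines the two real
      structures.\<close>
    have "M *\<^sub>v conjugate v = A *\<^sub>v conjugate (M *\<^sub>v v)"
      using v(1) A M AM by (simp add: conjugate_mult_mat_vec[of M 4 4] flip: assoc_mult_mat_vec[of A 4 4 _ 4])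
    then show "lin_map M (pconj p) = (lin_map A \<circ> pconj) (lin_map M p)"
      using v A M by (simp add: pconj_ppoint lin_map_ppoint[of _ 4 4])
  qed
  ultimately show ?thesis
    unfolding corresponds_eq_def corresponds_def using G real_variety_real_hypersurface[OF G] by blast
qed

section \<open>The matrices of the theorem\<close>

lemma all_less_4: "(\<forall>i<4. P i) \<longleftrightarrow> P 0 \<and> P 1 \<and> P 2 \<and> P (3 :: nat)"
  by (auto simp: numeral_eq_Suc less_Suc_eq)

lemma mat_4_eqI:
  assumes "A \<in> carrier_mat 4 4" and "B \<in> carrier_mat 4 4"
    and "\<forall>i<4. \<forall>j<4. A $$ (i, j) = B $$ (i, j)"
  shows "A = B"
  using assms by (intro eq_matI) auto

lemma scalar_prod_4:
  assumes "dim_vec w = 4"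
  shows "v \<bullet> w = v $ 0 * w $ 0 + v $ 1 * w $ 1 + v $ 2 * w $ 2 + v $ 3 * w $ 3"
  using assms by (simp add: scalar_prod_def numeral_eq_Suc)

text \<open>The lists hold the two diagonal blocks of size 2, row by row. All matrices of the
  theorem, and the matrices \<open>M\<close> and \<open>N\<close> used for them, have this shape, so
  products reduce to products of 2 by 2 blocks.\<close>

definition two_blocks :: "'a :: zero list \<Rightarrow> 'a list \<Rightarrow> 'a mat" where
  "two_blocks p q = mat_of_rows_list 4
     [[p ! 0, p ! 1, 0, 0], [p ! 2, p ! 3, 0, 0], [0, 0, q ! 0, q ! 1], [0, 0, q ! 2, q ! 3]]"

lemma two_blocks_carrier [simp]: "two_blocks p q \<in> carrier_mat 4 4"
  by (rule carrier_matI) (simp_all add: two_blocks_def mat_of_rows_list_def)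

lemma two_blocks_index:
  "i < 4 \<Longrightarrow> j < 4 \<Longrightarrow> two_blocks p q $$ (i, j) =
     [[p ! 0, p ! 1, 0, 0], [p ! 2, p ! 3, 0, 0], [0, 0, q ! 0, q ! 1], [0, 0, q ! 2, q ! 3]] ! i ! j"
  by (simp add: two_blocks_def mat_of_rows_list_def)

lemma two_blocks_mult:
  "two_blocks [a, b, c, d] [e, f, g, h] * two_blocks [a', b', c', d'] [e', f', g', h'] =
   two_blocks [a * a' + b * c', a * b' + b * d', c * a' + d * c', c * b' + d * d']
     [e * e' + f * g', e * f' + f * h', g * e' + h * g', g * f' + h * (h' :: complex)]"
  (is "?A * ?B = ?C")
proof (rule mat_4_eqI)
  show "\<forall>i<4. \<forall>j<4. (?A * ?B) $$ (i, j) = ?C $$ (i, j)"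
    unfolding all_less_4
    by (simp add: scalar_prod_4 carrier_matD[OF two_blocks_carrier] two_blocks_index)
qed (use mult_carrier_mat[OF two_blocks_carrier two_blocks_carrier] in auto)

lemma map_mat_cnj_two_blocks:
  "map_mat cnj (two_blocks [a, b, c, d] [e, f, g, h]) =
   two_blocks [cnj a, cnj b, cnj c, cnj d] [cnj e, cnj f, cnj g, cnj h]" (is "?A = ?B")
proof (rule mat_4_eqI)
  show "\<forall>i<4. \<forall>j<4. ?A $$ (i, j) = ?B $$ (i, j)"
    unfolding all_less_4 by (simp add: carrier_matD[OF two_blocks_carrier] two_blocks_index)
qed auto

lemma one_mat_two_blocks: "1\<^sub>m 4 = two_blocks [1, 0, 0, 1] [1, 0, 0, 1]" (is "?A = ?B")
proof (rule mat_4_eqI)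
  show "\<forall>i<4. \<forall>j<4. ?A $$ (i, j) = ?B $$ (i, j)"
    unfolding all_less_4 by (simp add: two_blocks_index)
qed auto

lemma smult_two_blocks:
  "x \<cdot>\<^sub>m two_blocks [a, b, c, d] [e, f, g, h] =
   two_blocks [x * a, x * b, x * c, x * d] [x * e, x * f, x * g, x * (h :: complex)]" (is "?A = ?B")
proof (rule mat_4_eqI)
  show "\<forall>i<4. \<forall>j<4. ?A $$ (i, j) = ?B $$ (i, j)"
    unfolding all_less_4 by (simp add: carrier_matD[OF two_blocks_carrier] two_blocks_index)
qed auto

lemma fermat_form_two_blocks:
  assumes "v \<in> carrier_vec 4"
  shows "fermat_form n (two_blocks [a, b, c, d] [e, f, g, h] *\<^sub>v v) =
    (a * v $ 0 + b * v $ 1) ^ n + (c * v $ 0 + d * v $ 1) ^ n +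
    (e * v $ 2 + f * v $ 3) ^ n + (g * v $ 2 + h * v $ 3) ^ n"
  using assms
  by (simp add: fermat_form_def carrier_matD[OF two_blocks_carrier] scalar_prod_4 two_blocks_index)

section \<open>Block form of the matrices H, K and L\<close>

lemma J_mat_simps:
  "dim_row J_mat = 2" "dim_col J_mat = 2"
  "J_mat $$ (0, 0) = 0" "J_mat $$ (0, Suc 0) = 1"
  "J_mat $$ (Suc 0, 0) = 1" "J_mat $$ (Suc 0, Suc 0) = 0"
  by (simp_all add: J_mat_def mat_of_rows_list_def)

lemma replicate_2: "replicate 2 x = [x, x]"
  by (simp add: numeral_2_eq_2)

lemma H_mat_two_blocks:
  "H_mat 4 = two_blocks [1, 0, 0, 1] [1, 0, 0, 1]"
  "H_mat 2 = two_blocks [1, 0, 0, 1] [0, 1, 1, 0]"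
  "H_mat 0 = two_blocks [0, 1, 1, 0] [0, 1, 1, 0]"
  unfolding H_mat_def
  by (rule mat_4_eqI;
    auto simp: all_less_4 two_blocks_index Let_def J_mat_simps replicate_2 intro!: carrier_matI)+

text \<open>Diagonal blocks of sizes such as 1 and 3 are regrouped into two blocks of size 2; blocks
  of size 0 contribute nothing.\<close>

lemma K_mat_two_blocks:
  "K_mat \<xi> 0 4 = two_blocks [1, 0, 0, 1] [1, 0, 0, 1]"
  "K_mat \<xi> 1 3 = two_blocks [\<xi>, 0, 0, 1] [1, 0, 0, 1]"
  "K_mat \<xi> 2 2 = two_blocks [\<xi>, 0, 0, \<xi>] [1, 0, 0, 1]"
  "K_mat \<xi> 0 2 = two_blocks [1, 0, 0, 1] [0, 1, 1, 0]"
  "K_mat \<xi> 1 1 = two_blocks [\<xi>, 0, 0, 1] [0, 1, 1, 0]"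
  "K_mat \<xi> 0 0 = two_blocks [0, 1, 1, 0] [0, 1, 1, 0]"
  unfolding K_mat_def
  by (rule mat_4_eqI;
    auto simp: all_less_4 two_blocks_index Let_def J_mat_simps replicate_2 intro!: carrier_matI)+

lemma L_mat_two_blocks: "L_mat = two_blocks [0, 1, -1, 0] [0, 1, -1, 0]"
  unfolding L_mat_def replicate_2
  by (rule mat_4_eqI;
    auto simp: all_less_4 two_blocks_index Let_def mat_of_rows_list_def intro!: carrier_matI)

text \<open>The power \<open>\<eta> ^ d\<close> equals \<open>\<xi> ^ (d div 2)\<close>, which
  squares to 1 but differs from 1 by primitivity, as \<open>d div 2\<close> lies strictly between 0
  and \<open>d\<close>. The norm of \<open>\<eta>\<close> is 1 because that of \<open>\<xi>\<close>
  is.\<close>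

lemma primitive_root_of_unity_sqrt:
  assumes "primitive_root_of_unity d \<xi>" and "even d"
  obtains \<eta> where "\<eta>\<^sup>2 = \<xi>" "\<eta> * cnj \<eta> = 1" "\<eta> ^ d = -1"
proof
  let ?\<eta> = "csqrt \<xi>"
  have d: "d > 0" "\<xi> ^ d = 1" and prim: "\<And>k. 0 < k \<Longrightarrow> k < d \<Longrightarrow> \<xi> ^ k \<noteq> 1"
    using assms(1) unfolding primitive_root_of_unity_def by auto
  show sq: "?\<eta>\<^sup>2 = \<xi>" by simp
  have "norm \<xi> ^ d = 1"
    using d(2) by (metis norm_one norm_power)
  then have "norm \<xi> = 1"
    using d(1) power_eq_imp_eq_base[of "norm \<xi>" d 1] by simp
  then have "norm ?\<eta> = 1"
    by simp
  then show "?\<eta> * cnj ?\<eta> = 1"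
    by (metis complex_norm_square of_real_1 power_one)
  have "?\<eta> ^ d = \<xi> ^ (d div 2)"
    using assms(2) sq by (metis dvd_mult_div_cancel power_mult)
  moreover have "\<xi> ^ (d div 2) \<noteq> 1"
    using prim[of "d div 2"] d(1) assms(2) by (auto elim!: evenE)
  moreover have "(\<xi> ^ (d div 2))\<^sup>2 = 1"
    using d(2) assms(2) by (metis dvd_div_mult_self power_mult)
  ultimately show "?\<eta> ^ d = -1"
    by (simp add: power2_eq_1_iff)
qed

section \<open>The correspondence\<close>

text \<open>Here \<open>M\<close> is diagonal with entries \<open>a\<close>, \<open>b\<close>, 1, 1
  on the unit circle, so its inverse is its conjugate. The squares in the cocycle are the quotients
  of these entries by their conjugates. Substituting \<open>M\<close> into the Fermat form produces
  the coefficients \<open>a ^ d\<close> and \<open>b ^ d\<close>.\<close>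

lemma corresponds_eq_diagonal:
  assumes "a * cnj a = 1" "b * cnj b = 1" "a ^ d \<in> \<real>" "b ^ d \<in> \<real>"
  shows "corresponds_eq d (two_blocks [a\<^sup>2, 0, 0, b\<^sup>2] [1, 0, 0, 1])
    (\<lambda>y. a ^ d * (y $ 0) ^ d + b ^ d * (y $ 1) ^ d + (y $ 2) ^ d + (y $ 3) ^ d)"
proof (rule corresponds_eq_lin_map)
  show "two_blocks [a, 0, 0, b] [1, 0, 0, 1] * two_blocks [cnj a, 0, 0, cnj b] [1, 0, 0, 1] = 1\<^sub>m 4"
    "two_blocks [cnj a, 0, 0, cnj b] [1, 0, 0, 1] * two_blocks [a, 0, 0, b] [1, 0, 0, 1] = 1\<^sub>m 4"
    using assms by (simp_all add: two_blocks_mult one_mat_two_blocks mult.commute)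
  show "two_blocks [a\<^sup>2, 0, 0, b\<^sup>2] [1, 0, 0, 1] * map_mat cnj (two_blocks [a, 0, 0, b] [1, 0, 0, 1]) =
      two_blocks [a, 0, 0, b] [1, 0, 0, 1]"
    using assms by (simp add: two_blocks_mult map_mat_cnj_two_blocks power2_eq_square mult.assoc)
  show "hom_form \<real> 3 d
      (\<lambda>y. a ^ d * (y $ 0) ^ d + b ^ d * (y $ 1) ^ d + (y $ 2) ^ d + (y $ 3) ^ d)"
    using assms by (intro hom_form_add hom_form_smult hom_form_coord_power) auto
qed (simp_all add: fermat_form_two_blocks power_mult_distrib)

text \<open>Conjugating the second block of \<open>M\<close> exchanges its rows
  \<open>(1, \<i>)\<close> and \<open>(1, -\<i>)\<close>, and multiplication by \<open>J\<close>
  exchanges them back; the first block is treated as in the diagonal case.\<close>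

lemma corresponds_eq_one_swap:
  assumes "a * cnj a = 1" "a ^ d \<in> \<real>"
  shows "corresponds_eq d (two_blocks [a\<^sup>2, 0, 0, 1] [0, 1, 1, 0])
    (\<lambda>y. a ^ d * (y $ 0) ^ d + (y $ 1) ^ d + (y $ 2 + \<i> * y $ 3) ^ d + (y $ 2 - \<i> * y $ 3) ^ d)"
proof (rule corresponds_eq_lin_map)
  let ?M = "two_blocks [a, 0, 0, 1] [1, \<i>, 1, -\<i>]"
    \<comment> \<open>The second block of \<open>?N\<close> recovers the two coordinates from
      \<open>y $ 2 + \<i> * y $ 3\<close> and \<open>y $ 2 - \<i> * y $ 3\<close> as half their sum
      and as their difference divided by \<open>2 * \<i>\<close>.\<close>
    and ?N = "two_blocks [cnj a, 0, 0, 1] [1/2, 1/2, -\<i>/2, \<i>/2]"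
  show "?M * ?N = 1\<^sub>m 4" "?N * ?M = 1\<^sub>m 4"
    using assms by (simp_all add: two_blocks_mult one_mat_two_blocks mult.commute)
  show "two_blocks [a\<^sup>2, 0, 0, 1] [0, 1, 1, 0] * map_mat cnj ?M = ?M"
    using assms by (simp add: two_blocks_mult map_mat_cnj_two_blocks power2_eq_square mult.assoc)
  \<comment> \<open>The conjugate powers are bracketed together because in general only their sum
    has real coefficients.\<close>
  have "hom_form \<real> 3 d (\<lambda>y. a ^ d * (y $ 0) ^ d + (y $ 1) ^ d +
      ((y $ 2 + \<i> * y $ 3) ^ d + (y $ 2 - \<i> * y $ 3) ^ d))"
    using assms
    by (intro hom_form_add hom_form_smult hom_form_coord_power hom_form_conjugate_powers) auto
  then show "hom_form \<real> 3 d (\<lambda>y. a ^ d * (y $ 0) ^ d + (y $ 1) ^ d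
      + (y $ 2 + \<i> * y $ 3) ^ d + (y $ 2 - \<i> * y $ 3) ^ d)"
    by (simp add: add.assoc)
qed (simp_all add: fermat_form_two_blocks power_mult_distrib)

lemma corresponds_eq_two_swaps:
  "corresponds_eq d (two_blocks [0, 1, 1, 0] [0, 1, 1, 0])
    (\<lambda>y. (y $ 0 + \<i> * y $ 1) ^ d + (y $ 0 - \<i> * y $ 1) ^ d
       + (y $ 2 + \<i> * y $ 3) ^ d + (y $ 2 - \<i> * y $ 3) ^ d)"
proof (rule corresponds_eq_lin_map)
  let ?M = "two_blocks [1, \<i>, 1, -\<i>] [1, \<i>, 1, -\<i>]"
    and ?N = "two_blocks [1/2, 1/2, -\<i>/2, \<i>/2] [1/2, 1/2, -\<i>/2, \<i>/2]"
  show "?M * ?N = 1\<^sub>m 4" "?N * ?M = 1\<^sub>m 4"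
    by (simp_all add: two_blocks_mult one_mat_two_blocks)
  show "two_blocks [0, 1, 1, 0] [0, 1, 1, 0] * map_mat cnj ?M = ?M"
    by (simp add: two_blocks_mult map_mat_cnj_two_blocks)
  have "hom_form \<real> 3 d (\<lambda>y. ((y $ 0 + \<i> * y $ 1) ^ d + (y $ 0 - \<i> * y $ 1) ^ d) +
      ((y $ 2 + \<i> * y $ 3) ^ d + (y $ 2 - \<i> * y $ 3) ^ d))"
    by (intro hom_form_add hom_form_conjugate_powers) auto
  then show "hom_form \<real> 3 d (\<lambda>y. (y $ 0 + \<i> * y $ 1) ^ d + (y $ 0 - \<i> * y $ 1) ^ d
      + (y $ 2 + \<i> * y $ 3) ^ d + (y $ 2 - \<i> * y $ 3) ^ d)"
    by (simp add: add.assoc)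
qed (simp_all add: fermat_form_two_blocks)

section \<open>The cocycle L and the real structure of Z\<close>

lemma Z_structure_eq:
  assumes "p \<in> proj_space 3"
  shows "Z_structure p = lin_map L_mat (pconj p)"
proof -
  have "vec_of_list [- cnj (z $ 1), cnj (z $ 0), - cnj (z $ 3), cnj (z $ 2)] =
      two_blocks [0, -1, 1, 0] [0, -1, 1, 0] *\<^sub>v conjugate z" (is "?l = ?r") if "z \<in> p" for z
  proof -
    have z: "dim_vec z = 4"
      using ppoint_representative(1)[OF assms that] by simp
    have "\<forall>i<4. ?l $ i = ?r $ i"
      unfolding all_less_4 using z
      by (simp add: carrier_matD[OF two_blocks_carrier] scalar_prod_4 two_blocks_index
          vec_of_list_index del: vec_of_list_Cons)
    then show ?thesis
      by (intro eq_vecI) (simp_all add: carrier_matD[OF two_blocks_carrier])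
  qed
  then have "Z_structure p = lin_map (two_blocks [0, -1, 1, 0] [0, -1, 1, 0]) (pconj p)"
    unfolding Z_structure_def lin_map_def pconj_def image_image by (intro image_cong) auto
  \<comment> \<open>The two matrices differ by the factor -1, which fixes every point.\<close>
  also have "\<dots> = lin_map L_mat (pconj p)"
  proof -
    obtain v where v: "v \<in> carrier_vec (3 + 1)" "p = ppoint v"
      using assms by (rule ppoint_cases)
    have "two_blocks [0, -1, 1, 0] [0, -1, 1, 0] = (-1 :: complex) \<cdot>\<^sub>m L_mat"
      by (simp add: L_mat_two_blocks smult_two_blocks)
    moreover have "((-1) \<cdot>\<^sub>m L_mat) *\<^sub>v conjugate v = (-1) \<cdot>\<^sub>v (L_mat *\<^sub>v conjugate v)"
      using v by (intro eq_vecI) (auto simp: L_mat_two_blocks carrier_matD[OF two_blocks_carrier])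
    ultimately show ?thesis
      using v by (simp add: pconj_ppoint lin_map_ppoint[of _ 4 4] ppoint_smult L_mat_two_blocks)
  qed
  finally show ?thesis .
qed

text \<open>A cocycle treated by \<open>corresponds_eq_lin_map\<close> satisfies
  \<open>A * map_mat cnj A = 1\<^sub>m 4\<close>, whereas for \<open>L_mat\<close> this product is
  minus the identity; so \<open>L_mat\<close> is handled directly. Since \<open>d\<close> is even,
  the signs in \<open>L_mat\<close> leave the Fermat form unchanged.\<close>

lemma corresponds_L_mat:
  assumes "even d"
  shows "corresponds d L_mat (Z_var d)"
proof -
  have L: "L_mat \<in> carrier_mat 4 4" "map_mat cnj L_mat = L_mat"
    by (simp_all add: L_mat_two_blocks map_mat_cnj_two_blocks)
  have LL: "L_mat * map_mat cnj L_mat = (-1) \<cdot>\<^sub>m 1\<^sub>m 4"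
    by (simp add: L_mat_two_blocks map_mat_cnj_two_blocks two_blocks_mult one_mat_two_blocks
        smult_two_blocks)
  have inv: "fermat_form d (L_mat *\<^sub>v v) = fermat_form d v" if "v \<in> carrier_vec 4" for v
    using assms that unfolding L_mat_two_blocks fermat_form_two_blocks[OF that]
    by (simp add: fermat_form_def)
  have coc: "cocycle d (lin_map L_mat)"
    by (rule cocycle_lin_map[OF L(1) LL]) (simp_all add: inv)
  have sub: "fermat d \<subseteq> proj_space 3"
    unfolding fermat_eq by (rule proj_zeros_subset)
  have Z: "Z_structure p = (lin_map L_mat \<circ> pconj) p" if "p \<in> fermat d" for p
    using that sub Z_structure_eq by auto
  have conj: "pconj ` fermat d = fermat d"
    unfolding fermat_eq by (rule pconj_proj_zeros[OF hom_form_fermat])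
  have img: "lin_map L_mat ` fermat d \<subseteq> fermat d"
    using coc unfolding cocycle_def biregular_def regular_map_def by (elim conjE)
  have Zimg: "Z_structure ` fermat d \<subseteq> fermat d"
  proof
    fix q assume "q \<in> Z_structure ` fermat d"
    then obtain p where p: "p \<in> fermat d" "q = lin_map L_mat (pconj p)"
      using Z by auto
    then have "pconj p \<in> fermat d"
      using conj by blast
    then show "q \<in> fermat d"
      using p img by blast
  qed
  \<comment> \<open>As a real matrix with square -1, \<open>L_mat\<close> is its own inverse up to a
    scalar.\<close>
  have L': "L_mat \<in> carrier_mat (3 + 1) (3 + 1)" "L_mat * L_mat = (-1) \<cdot>\<^sub>m 1\<^sub>m (3 + 1)"
    using L LL by simp_all
  have "real_structure 3 (fermat d) Z_structure"
    unfolding real_structure_def conj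
  proof (intro conjI ballI)
    show "Z_structure ` fermat d \<subseteq> fermat d"
      by (rule Zimg)
    show "Z_structure (Z_structure p) = p" if "p \<in> fermat d" for p
    proof -
      have "Z_structure p \<in> fermat d"
        using that Zimg by blast
      then show ?thesis
        using that coc unfolding cocycle_def by (simp add: Z)
    qed
    \<comment> \<open>Conjugating before and after \<open>L_mat\<close> amounts to applying the
      conjugate matrix, which is \<open>L_mat\<close> itself.\<close>
    show "regular_map 3 (fermat d) 3 (fermat d) (pconj \<circ> Z_structure)"
    proof (rule regular_map_lin_map[OF L'(1,1,2) _ sub img])
      fix p assume p: "p \<in> fermat d"
      then obtain v where v: "v \<in> carrier_vec (3 + 1)" "p = ppoint v"
        using sub ppoint_cases by blast
      show "(pconj \<circ> Z_structure) p = lin_map L_mat p"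
        using v L Z[OF p]
        by (simp add: pconj_ppoint lin_map_ppoint[of _ 4 4] conjugate_mult_mat_vec[of L_mat 4 4])
    qed simp
  qed
  then have "real_variety 3 (Z_var d)"
    unfolding real_variety_def Z_var_def fermat_eq
    using zariski_closed_proj_zeros[OF hom_form_fermat] by simp
  \<comment> \<open>The identity is an isomorphism, as both real structures agree on the Fermat
    surface.\<close>
  moreover have "real_isomorphic 3 (Z_var d) 3 (quotient_by_cocycle d (lin_map L_mat))"
    unfolding real_isomorphic_def Z_var_def quotient_by_cocycle_def biregular_def fst_conv snd_conv
    using regular_map_id[OF sub, of "fermat d" "\<lambda>p. p"] Z
    by (intro exI[of _ "\<lambda>p. p"] conjI) auto
  ultimately show ?thesis
    unfolding corresponds_def using coc by blast
qed

theorem theorem6p3: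
  fixes d :: nat and \<xi> :: complex
  assumes "d \<ge> 3" and "d \<noteq> 4" and "primitive_root_of_unity d \<xi>"
  shows
    "(odd d \<longrightarrow>
       corresponds_eq d (H_mat 4)
         (\<lambda>y. (y $ 0) ^ d + (y $ 1) ^ d + (y $ 2) ^ d + (y $ 3) ^ d) \<and>
       corresponds_eq d (H_mat 2)
         (\<lambda>y. (y $ 0) ^ d + (y $ 1) ^ d
            + (y $ 2 + \<i> * y $ 3) ^ d + (y $ 2 - \<i> * y $ 3) ^ d) \<and>
       corresponds_eq d (H_mat 0)
         (\<lambda>y. (y $ 0 + \<i> * y $ 1) ^ d + (y $ 0 - \<i> * y $ 1) ^ d
            + (y $ 2 + \<i> * y $ 3) ^ d + (y $ 2 - \<i> * y $ 3) ^ d)) \<and>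
     (even d \<longrightarrow>
       corresponds_eq d (K_mat \<xi> 0 4)
         (\<lambda>y. (y $ 0) ^ d + (y $ 1) ^ d + (y $ 2) ^ d + (y $ 3) ^ d) \<and>
       corresponds_eq d (K_mat \<xi> 1 3)
         (\<lambda>y. - ((y $ 0) ^ d) + (y $ 1) ^ d + (y $ 2) ^ d + (y $ 3) ^ d) \<and>
       corresponds_eq d (K_mat \<xi> 2 2)
         (\<lambda>y. - ((y $ 0) ^ d) - (y $ 1) ^ d + (y $ 2) ^ d + (y $ 3) ^ d) \<and>
       corresponds_eq d (K_mat \<xi> 0 2)
         (\<lambda>y. (y $ 0) ^ d + (y $ 1) ^ d
            + (y $ 2 + \<i> * y $ 3) ^ d + (y $ 2 - \<i> * y $ 3) ^ d) \<and>
       corresponds_eq d (K_mat \<xi> 1 1)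
         (\<lambda>y. - ((y $ 0) ^ d) + (y $ 1) ^ d
            + (y $ 2 + \<i> * y $ 3) ^ d + (y $ 2 - \<i> * y $ 3) ^ d) \<and>
       corresponds_eq d (K_mat \<xi> 0 0)
         (\<lambda>y. (y $ 0 + \<i> * y $ 1) ^ d + (y $ 0 - \<i> * y $ 1) ^ d
            + (y $ 2 + \<i> * y $ 3) ^ d + (y $ 2 - \<i> * y $ 3) ^ d) \<and>
       corresponds d L_mat (Z_var d))"
proof (intro conjI impI)
  \<comment> \<open>The matrices without an entry \<open>\<xi>\<close> coincide in the two lists, so
    each of these three equations is obtained for both at once, with \<open>a\<close> and
    \<open>b\<close> equal to 1 where they occur.\<close>
  show "corresponds_eq d (H_mat 4) (\<lambda>y. (y $ 0) ^ d + (y $ 1) ^ d + (y $ 2) ^ d + (y $ 3) ^ d)"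
    and "corresponds_eq d (K_mat \<xi> 0 4)
      (\<lambda>y. (y $ 0) ^ d + (y $ 1) ^ d + (y $ 2) ^ d + (y $ 3) ^ d)"
    using corresponds_eq_diagonal[of 1 1 d] by (simp_all add: H_mat_two_blocks K_mat_two_blocks)
  show "corresponds_eq d (H_mat 2) (\<lambda>y. (y $ 0) ^ d + (y $ 1) ^ d
      + (y $ 2 + \<i> * y $ 3) ^ d + (y $ 2 - \<i> * y $ 3) ^ d)"
    and "corresponds_eq d (K_mat \<xi> 0 2) (\<lambda>y. (y $ 0) ^ d + (y $ 1) ^ d
      + (y $ 2 + \<i> * y $ 3) ^ d + (y $ 2 - \<i> * y $ 3) ^ d)"
    using corresponds_eq_one_swap[of 1 d] by (simp_all add: H_mat_two_blocks K_mat_two_blocks)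
  show "corresponds_eq d (H_mat 0) (\<lambda>y. (y $ 0 + \<i> * y $ 1) ^ d + (y $ 0 - \<i> * y $ 1) ^ d
      + (y $ 2 + \<i> * y $ 3) ^ d + (y $ 2 - \<i> * y $ 3) ^ d)"
    and "corresponds_eq d (K_mat \<xi> 0 0) (\<lambda>y. (y $ 0 + \<i> * y $ 1) ^ d + (y $ 0 - \<i> * y $ 1) ^ d
      + (y $ 2 + \<i> * y $ 3) ^ d + (y $ 2 - \<i> * y $ 3) ^ d)"
    using corresponds_eq_two_swaps[of d] by (simp_all only: H_mat_two_blocks K_mat_two_blocks)
next
  assume "even d"
  \<comment> \<open>Each use of \<open>\<eta>\<close> as a diagonal entry of \<open>M\<close> puts
    \<open>\<xi>\<close> into the cocycle and the sign -1 into the equation.\<close>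
  obtain \<eta> where \<eta>: "\<eta>\<^sup>2 = \<xi>" "\<eta> * cnj \<eta> = 1" "\<eta> ^ d = -1"
    using primitive_root_of_unity_sqrt[OF assms(3) \<open>even d\<close>] .
  show "corresponds_eq d (K_mat \<xi> 1 3)
      (\<lambda>y. - ((y $ 0) ^ d) + (y $ 1) ^ d + (y $ 2) ^ d + (y $ 3) ^ d)"
    using corresponds_eq_diagonal[of \<eta> 1 d] \<eta> by (simp add: K_mat_two_blocks[unfolded One_nat_def])
  show "corresponds_eq d (K_mat \<xi> 2 2)
      (\<lambda>y. - ((y $ 0) ^ d) - (y $ 1) ^ d + (y $ 2) ^ d + (y $ 3) ^ d)"
    using corresponds_eq_diagonal[of \<eta> \<eta> d] \<eta> by (simp add: K_mat_two_blocks)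
  show "corresponds_eq d (K_mat \<xi> 1 1) (\<lambda>y. - ((y $ 0) ^ d) + (y $ 1) ^ d
      + (y $ 2 + \<i> * y $ 3) ^ d + (y $ 2 - \<i> * y $ 3) ^ d)"
    using corresponds_eq_one_swap[of \<eta> d] \<eta> by (simp add: K_mat_two_blocks[unfolded One_nat_def])
  show "corresponds d L_mat (Z_var d)"
    using \<open>even d\<close> by (rule corresponds_L_mat)
qed

end
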